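(* Let $N_A=[NA(n,k)]_{n,k\geq 0}$ be the infinite lower-triangular matrix with entries $NA(n,k)=\frac{1}{k+1}\binom{n+1}{k}\binom{n}{k}$ for $0\le k\le n$ and $NA(n,k)=0$ for $k>n$ (the Narayana triangle of type $A$), and let $N_B=[NB(n,k)]_{n,k\geq 0}$ be the infinite lower-triangular matrix with entries $NB(n,k)=\binom{n}{k}^2$ (which vanishes for $k>n$) (the Narayana triangle of type $B$). Then both $N_A$ and $N_B$ are totally positive.
   Context: A (finite or infinite) real matrix is totally positive (TP) if all of its minors are nonnegative. *)

theory Defs
  imports Complex_Main "Jordan_Normal_Form.Determinant"
begin

text \<open>An infinite real matrix is a function \<open>nat \<Rightarrow> nat \<Rightarrow> real\<close>, rows and columns both indexed from 0.\<close>

text \<open>The minor of order \<open>r\<close> on the rows \<open>f 0, \<dots>, f (r - 1)\<close> and the columns \<open>g 0, \<dots>, g (r - 1)\<close>;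
  it is a minor in the usual sense when both index sequences are strictly increasing below \<open>r\<close>.\<close>

definition minor :: "(nat \<Rightarrow> nat \<Rightarrow> real) \<Rightarrow> nat \<Rightarrow> (nat \<Rightarrow> nat) \<Rightarrow> (nat \<Rightarrow> nat) \<Rightarrow> real" where
  "minor M r f g = det (mat r r (\<lambda>(i, j). M (f i) (g j)))"

text \<open>The case \<open>r = 0\<close> is harmless: the empty determinant is 1.\<close>

definition totally_positive :: "(nat \<Rightarrow> nat \<Rightarrow> real) \<Rightarrow> bool" where
  "totally_positive M \<longleftrightarrow>
     (\<forall>r f g. strict_mono_on {..<r} f \<longrightarrow> strict_mono_on {..<r} g \<longrightarrow> minor M r f g \<ge> 0)"

definition narayana_A :: "nat \<Rightarrow> nat \<Rightarrow> real" where
  "narayana_A n k =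
     (if k \<le> n then 1 / (real k + 1) * real ((n + 1) choose k) * real (n choose k) else 0)"

definition narayana_B :: "nat \<Rightarrow> nat \<Rightarrow> real" where
  "narayana_B n k = (real (n choose k))\<^sup>2"

end

theory Submission
  imports Defs "HOL-Computational_Algebra.Polynomial"
begin

text \<open>Up to nonnegative diagonal scaling of rows and columns, both triangles are Toeplitz matrices
  of the sequence \<open>1 / (m! (m + a)!)\<close>, with \<open>a = 1\<close> for type A and \<open>a = 0\<close> for type B. This sequence
  is a limit of rescaled coefficient sequences of the Laguerre polynomials \<open>L\<^sub>N\<^sup>(\<^sup>a\<^sup>)(-x)\<close>. These have
  \<open>N\<close> distinct negative roots by Rolle's theorem, so their Toeplitz matrices are products of
  nonnegative bidiagonal matrices, and multiplication by such a matrix preserves total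
  positivity.\<close>

section \<open>Minors: Leibniz expansion and row operations\<close>

lemma minor_eq_sum:
  "minor M r f g = (\<Sum>p | p permutes {0..<r}. signof p * (\<Prod>i = 0..<r. M (f i) (g (p i))))"
proof -
  have *: "mat r r (\<lambda>(i, j). M (f i) (g j)) \<in> carrier_mat r r" by simp
  show ?thesis
    unfolding minor_def det_def'[OF *]
    by (intro sum.cong refl arg_cong2[of _ _ _ _ "(*)"] prod.cong)
      (auto dest: permutes_in_image)
qed

lemma minor_cong:
  assumes "\<And>i j. i < r \<Longrightarrow> j < r \<Longrightarrow> M (f i) (g j) = M' (f' i) (g' j)"
  shows "minor M r f g = minor M' r f' g'"
  unfolding minor_def using assms by (intro arg_cong[of _ _ det] cong_mat) auto

text \<open>Rows are addressed by position (\<open>id\<close>), so row \<open>k\<close> can be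
  replaced alone even when a row selection repeats an index.\<close>

lemma minor_row_linear:
  assumes "k < r"
  shows "minor (A(k := \<lambda>j. c * u j + d * v j)) r id id =
    c * minor (A(k := u)) r id id + d * minor (A(k := v)) r id id"
proof -
  have split: "(\<Prod>i = 0..<r. (A(k := w)) (id i) (id (p i))) = w (p k) * (\<Prod>i \<in> {0..<r} - {k}. A i (p i))"
    for w p
    using assms by (subst prod.remove[of _ k]) auto
  show ?thesis
    unfolding minor_eq_sum split
    by (simp add: sum_distrib_left sum.distrib algebra_simps)
qed

lemma minor_equal_rows:
  assumes "i < r" "k < r" "i \<noteq> k" "f i = f k"
  shows "minor M r f g = 0"
  unfolding minor_def using assms
  by (intro det_identical_rows[of _ r i k]) (auto intro!: eq_vecI)

section \<open>Operations that preserve total positivity\<close>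

text \<open>A repeated row makes the minor vanish. Such repetitions arise below when a row index is
  lowered by one.\<close>

lemma totally_positiveD_mono:
  assumes M: "totally_positive M" and g: "strict_mono_on {..<r} g" and f: "mono_on {..<r} f"
  shows "0 \<le> minor M r f g"
proof (cases "inj_on f {..<r}")
  case True
  then have "strict_mono_on {..<r} f"
    using f by (intro strict_mono_onI) (metis inj_onD mono_onD order.strict_iff_order)
  then show ?thesis using M g by (simp add: totally_positive_def)
next
  case False
  then show ?thesis by (auto simp: inj_on_def intro: minor_equal_rows[symmetric] eq_refl)
qed

text \<open>This is left multiplication by the matrix with \<open>c\<close> on the diagonal and
  \<open>d\<close> on the subdiagonal. Multilinearity takes the place of Cauchy-Binet: row by row, a
  minor splits into one using row \<open>f t\<close> and one using row \<open>f t - 1\<close> of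
  \<open>M\<close>.\<close>

lemma totally_positive_bidiagonal_mult:
  assumes M: "totally_positive M" and c: "0 \<le> c" and d: "0 \<le> d"
  shows "totally_positive (\<lambda>n k. c * M n k + d * (if n = 0 then 0 else M (n - 1) k))"
    (is "totally_positive ?M'")
proof -
  \<comment> \<open>Expanding row \<open>t\<close> may make it coincide with the row above it, but row indices stay weakly
    increasing: the rows not yet replaced need only satisfy this weaker condition.\<close>
  have mixed: "0 \<le> minor (\<lambda>i j. (if i < t then ?M' else M) (f i) (g j)) r id id"
    if "t \<le> r" "strict_mono_on {..<t} f" "mono_on {..<r} f" and g: "strict_mono_on {..<r} g"
    for r t f g
    using that(1-3)
  proof (induction t arbitrary: f)
    case 0
    have "minor (\<lambda>i j. M (f i) (g j)) r id id = minor M r f g"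
      by (rule minor_cong) simp
    then show ?case using totally_positiveD_mono[OF M g \<open>mono_on {..<r} f\<close>] by (simp only: not_less0 if_False)
  next
    case (Suc t)
    let ?A = "\<lambda>f i j. (if i < t then ?M' else M) (f i) (g j)"
    \<comment> \<open>At \<open>f t = 0\<close> the subtraction truncates to row 0;
      \<open>?d = 0\<close> removes that spurious term.\<close>
    let ?f' = "f(t := f t - 1)"
    let ?d = "if f t = 0 then 0 else d"
    have t: "t < r" using Suc.prems by simp
    have f: "strict_mono_on {..<t} f"
      using Suc.prems(2) by (rule monotone_on_subset) auto
    have "minor (\<lambda>i j. (if i < Suc t then ?M' else M) (f i) (g j)) r id id =
        minor ((?A f)(t := \<lambda>j. c * M (f t) (g j) + ?d * M (f t - 1) (g j))) r id id"
      by (rule minor_cong) auto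
    also have "\<dots> = c * minor ((?A f)(t := \<lambda>j. M (f t) (g j))) r id id +
        ?d * minor ((?A f)(t := \<lambda>j. M (f t - 1) (g j))) r id id"
      by (rule minor_row_linear[OF t])
    also have "minor ((?A f)(t := \<lambda>j. M (f t) (g j))) r id id = minor (?A f) r id id"
      by (rule minor_cong) auto
    also have "minor ((?A f)(t := \<lambda>j. M (f t - 1) (g j))) r id id = minor (?A ?f') r id id"
      by (rule minor_cong) auto
    finally have eq: "minor (\<lambda>i j. (if i < Suc t then ?M' else M) (f i) (g j)) r id id =
        c * minor (?A f) r id id + ?d * minor (?A ?f') r id id" .
    have less: "f i < f t" if "i < t" for i
      using Suc.prems(2) that by (auto simp: strict_mono_on_def)
    have le: "f i \<le> f j" if "i \<le> j" "j < r" for i j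
      using Suc.prems(3) that by (auto simp: mono_on_def)
    have f': "strict_mono_on {..<t} ?f'" using f by (auto simp: strict_mono_on_def)
    \<comment> \<open>For \<open>i < t\<close>, strictness up to \<open>t\<close> leaves room for
      the decrement: \<open>f i < f t\<close> gives \<open>f i \<le> f t - 1\<close>.\<close>
    have f'm: "mono_on {..<r} ?f'"
    proof (rule mono_onI)
      fix i j assume "i \<in> {..<r}" "j \<in> {..<r}" "i \<le> j"
      then show "?f' i \<le> ?f' j"
        using le[of i j] less[of i] by auto
    qed
    have "0 \<le> minor (?A f) r id id"
      by (rule Suc.IH[OF less_imp_le[OF t] f Suc.prems(3)])
    moreover have "0 \<le> minor (?A ?f') r id id"
      by (rule Suc.IH[OF less_imp_le[OF t] f' f'm])
    ultimately show ?case unfolding eq using c d by (intro add_nonneg_nonneg mult_nonneg_nonneg) auto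
  qed
  show ?thesis
    unfolding totally_positive_def
  proof (intro allI impI)
    fix r :: nat and f g :: "nat \<Rightarrow> nat"
    assume f: "strict_mono_on {..<r} f" and g: "strict_mono_on {..<r} g"
    have "minor ?M' r f g = minor (\<lambda>i j. (if i < r then ?M' else M) (f i) (g j)) r id id"
      by (rule minor_cong) auto
    also have "0 \<le> \<dots>"
      using mixed[OF order_refl f _ g] f strict_mono_on_imp_mono_on by blast
    finally show "0 \<le> minor ?M' r f g" .
  qed
qed

lemma permutes_strict_mono_on_eq_id:
  assumes p: "p permutes {0..<r}" and mono: "strict_mono_on {..<r} p"
  shows "p = (id :: nat \<Rightarrow> nat)"
proof (rule permutes_natset_ge[OF p], rule ballI)
  fix i assume "i \<in> {0..<r}"
  then show "i \<le> p i"
  proof (induction i)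
    case (Suc i)
    then have "p i < p (Suc i)" using mono by (auto simp: strict_mono_on_def)
    then show ?case using Suc by simp
  qed simp
qed

text \<open>A Leibniz term survives only if \<open>f i = g (p i)\<close> for all
  \<open>i < r\<close>. As both selections increase, so does \<open>p\<close>, which forces
  \<open>p = id\<close> with sign 1.\<close>

lemma totally_positive_identity: "totally_positive (\<lambda>n k. if n = k then 1 else 0)"
  unfolding totally_positive_def minor_eq_sum
proof (intro allI impI sum_nonneg)
  fix r :: nat and f g p :: "nat \<Rightarrow> nat"
  assume f: "strict_mono_on {..<r} f" and g: "strict_mono_on {..<r} g"
    and "p \<in> {p. p permutes {0..<r}}"
  then have p: "p permutes {0..<r}" by simp
  let ?P = "\<Prod>i = 0..<r. if f i = g (p i) then 1 else 0 :: real"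
  show "0 \<le> signof p * ?P"
  proof (cases "\<forall>i<r. f i = g (p i)")
    case True
    have "strict_mono_on {..<r} p"
    proof (rule strict_mono_onI)
      fix i j assume ij: "i \<in> {..<r}" "j \<in> {..<r}" "i < j"
      then have "g (p i) < g (p j)" using True f by (auto simp: strict_mono_on_def)
      moreover have "p i < r" "p j < r" using ij permutes_in_image[OF p] by auto
      ultimately show "p i < p j"
        using g by (metis lessThan_iff linorder_less_linear order.asym strict_mono_onD)
    qed
    then have "p = id" by (rule permutes_strict_mono_on_eq_id[OF p])
    then show ?thesis by (simp add: prod_nonneg)
  next
    case False
    then have "?P = 0" by (intro prod_zero) auto
    then show ?thesis by (simp only: mult_zero_right order_refl)
  qed
qed

text \<open>A permutation only reorders the column factors, so every Leibniz term acquires the same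
  nonnegative factor.\<close>

lemma totally_positive_diagonal_scale:
  assumes M: "totally_positive M" and "\<And>n. 0 \<le> c n" "\<And>k. 0 \<le> d k"
  shows "totally_positive (\<lambda>n k. c n * d k * M n k)"
  unfolding totally_positive_def
proof (intro allI impI)
  fix r :: nat and f g :: "nat \<Rightarrow> nat"
  assume fg: "strict_mono_on {..<r} f" "strict_mono_on {..<r} g"
  have perm: "(\<Prod>i = 0..<r. d (g (p i))) = (\<Prod>i = 0..<r. d (g i))" if "p permutes {0..<r}" for p
    using prod.permute[OF that, of "\<lambda>i. d (g i)"] by (simp add: o_def)
  have "minor (\<lambda>n k. c n * d k * M n k) r f g =
      (\<Prod>i = 0..<r. c (f i)) * (\<Prod>i = 0..<r. d (g i)) * minor M r f g"
    unfolding minor_eq_sum sum_distrib_left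
    by (intro sum.cong refl) (simp add: prod.distrib perm)
  also have "\<dots> \<ge> 0"
    using assms fg by (auto simp: totally_positive_def intro!: mult_nonneg_nonneg prod_nonneg)
  finally show "0 \<le> minor (\<lambda>n k. c n * d k * M n k) r f g" .
qed

text \<open>Each minor is a polynomial in finitely many entries, hence continuous under entrywise
  limits.\<close>

lemma totally_positive_LIMSEQ:
  assumes M: "\<And>N. totally_positive (M N)" and lim: "\<And>n k. (\<lambda>N. M N n k) \<longlonglongrightarrow> L n k"
  shows "totally_positive L"
  unfolding totally_positive_def
proof (intro allI impI)
  fix r :: nat and f g :: "nat \<Rightarrow> nat"
  assume fg: "strict_mono_on {..<r} f" "strict_mono_on {..<r} g"
  have "(\<lambda>N. minor (M N) r f g) \<longlonglongrightarrow> minor L r f g"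
    unfolding minor_eq_sum by (intro tendsto_intros lim)
  then show "0 \<le> minor L r f g"
    using M fg by (auto simp: totally_positive_def intro: LIMSEQ_le_const)
qed

section \<open>Toeplitz matrices of polynomials with nonpositive roots\<close>

definition toeplitz :: "(nat \<Rightarrow> real) \<Rightarrow> nat \<Rightarrow> nat \<Rightarrow> real" where
  "toeplitz a n k = (if k \<le> n then a (n - k) else 0)"

text \<open>Multiplying the polynomial by \<open>[:- z N, 1:]\<close> turns each Toeplitz row into
  \<open>- z N\<close> times itself plus the row above, a bidiagonal step with nonnegative
  coefficients.\<close>

lemma totally_positive_toeplitz_linear_factors:
  fixes N :: nat
  assumes "\<And>i. i < N \<Longrightarrow> z i \<le> 0"
  shows "totally_positive (toeplitz (coeff (\<Prod>i<N. [:- z i, 1:])))"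
  using assms
proof (induction N)
  case 0
  have "toeplitz (coeff 1) = (\<lambda>n k. if n = k then 1 else 0)"
    by (auto simp: toeplitz_def fun_eq_iff)
  then show ?case using totally_positive_identity by (simp only: lessThan_0 prod.empty)
next
  case (Suc N)
  let ?T = "toeplitz (coeff (\<Prod>i<N. [:- z i, 1:]))"
  have "toeplitz (coeff (\<Prod>i<Suc N. [:- z i, 1:])) =
      (\<lambda>n k. - z N * ?T n k + 1 * (if n = 0 then 0 else ?T (n - 1) k))"
    by (auto simp: toeplitz_def fun_eq_iff coeff_pCons mult.commute[of _ "[:_, 1:]"] Suc_diff_le
        split: nat.split intro!: arg_cong[where f = "coeff _"])
  moreover have "totally_positive \<dots>"
    using Suc by (intro totally_positive_bidiagonal_mult) auto
  ultimately show ?case by (simp only:)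
qed


section \<open>Negative roots of the Laguerre polynomials\<close>

text \<open>The limit 0 at minus infinity plays the role of a second zero of \<open>f\<close> to the
  left of \<open>b\<close>.\<close>

lemma Rolle_at_bot:
  fixes f f' :: "real \<Rightarrow> real"
  assumes der: "\<And>x. (f has_real_derivative f' x) (at x)"
    and lim: "(f \<longlongrightarrow> 0) at_bot" and b: "f b = 0"
  shows "\<exists>z<b. f' z = 0"
\<comment> \<open>\<open>b - 1\<close> is an arbitrary point below \<open>b\<close>: if
  \<open>f\<close> vanishes there, ordinary Rolle applies; otherwise its absolute value there is a
  positive threshold.\<close>
proof (cases "f (b - 1) = 0")
  case True
  have cont: "continuous_on {b - 1..b} f"
    using der by (meson DERIV_isCont continuous_at_imp_continuous_on)
  have "\<exists>z. b - 1 < z \<and> z < b \<and> (f has_real_derivative 0) (at z)"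
    using True b der by (intro Rolle cont) (auto simp: real_differentiable_def)
  then show ?thesis using der DERIV_unique by blast
next
  case False
  then have "\<forall>\<^sub>F x in at_bot. \<bar>f x\<bar> < \<bar>f (b - 1)\<bar>"
    using lim by (intro order_tendstoD(2)[OF tendsto_rabs_zero]) auto
  moreover have "\<forall>\<^sub>F x in at_bot. x < b - 1" by (rule eventually_gt_at_bot)
  ultimately have "\<exists>M. \<bar>f M\<bar> < \<bar>f (b - 1)\<bar> \<and> M < b - 1"
    by (intro eventually_happens'[of at_bot] eventually_conj) auto
  then obtain M where M: "\<bar>f M\<bar> < \<bar>f (b - 1)\<bar>" "M < b - 1" by blast
  \<comment> \<open>Squaring handles both signs of \<open>f\<close> at once. The maximum is interior
    because the value at \<open>b - 1\<close> exceeds those at \<open>M\<close> and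
    \<open>b\<close>.\<close>
  have "continuous_on {M..b} (\<lambda>x. (f x)\<^sup>2)"
    using der by (intro continuous_intros) (meson DERIV_isCont continuous_at_imp_continuous_on)
  then obtain z where z: "z \<in> {M..b}" and max: "\<And>x. x \<in> {M..b} \<Longrightarrow> (f x)\<^sup>2 \<le> (f z)\<^sup>2"
    using continuous_attains_sup[of "{M..b}" "\<lambda>x. (f x)\<^sup>2"] M by auto
  have big: "\<bar>f (b - 1)\<bar> \<le> \<bar>f z\<bar>" using max[of "b - 1"] M by (simp add: abs_le_square_iff)
  then have "z \<noteq> M" "z \<noteq> b" "f z \<noteq> 0" using M b False by auto
  then have z: "M < z" "z < b" using z by auto
  have "((\<lambda>x. (f x)\<^sup>2) has_real_derivative 2 * f z * f' z) (at z)"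
    by (auto intro!: derivative_eq_intros der)
  then have "2 * f z * f' z = 0"
  proof (rule DERIV_local_max[where d = "min (z - M) (b - z)"])
    show "\<forall>y. \<bar>z - y\<bar> < min (z - M) (b - z) \<longrightarrow> (f y)\<^sup>2 \<le> (f z)\<^sup>2"
      using max by (auto simp: abs_if split: if_splits)
  qed (use z in auto)
  then show ?thesis using \<open>f z \<noteq> 0\<close> z by auto
qed

lemma tendsto_poly_times_exp_at_bot: "((\<lambda>x. poly p x * exp x) \<longlongrightarrow> (0::real)) at_bot"
proof -
  have *: "((\<lambda>x::real. x ^ k * exp x) \<longlongrightarrow> 0) at_bot" for k
  proof -
    have "((\<lambda>x::real. (- 1) ^ k * (x ^ k / exp x)) \<longlongrightarrow> (- 1) ^ k * 0) at_top"
      by (intro tendsto_intros tendsto_power_div_exp_0)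
    moreover have "(- x) ^ k * exp (- x) = (- 1) ^ k * (x ^ k / exp x)" for x :: real
      by (subst power_minus) (simp add: exp_minus divide_inverse)
    ultimately show ?thesis
      unfolding filterlim_at_bot_mirror by simp
  qed
  have "((\<lambda>x. \<Sum>i\<le>degree p. coeff p i * (x ^ i * exp x)) \<longlongrightarrow> (\<Sum>i\<le>degree p. coeff p i * 0)) at_bot"
    by (intro tendsto_intros *)
  then show ?thesis by (simp add: poly_altdef sum_distrib_right mult.assoc)
qed

text \<open>This is \<open>N!\<close> times the generalized Laguerre polynomial \<open>L\<^sub>N\<^sup>(\<^sup>a\<^sup>)(-x)\<close>. The recursion says that
  \<open>x\<^sup>N\<^sup>+\<^sup>a e\<^sup>x laguerre a (N + 1)\<close> is the derivative of \<open>x\<^sup>N\<^sup>+\<^sup>1\<^sup>+\<^sup>a e\<^sup>x laguerre a N\<close>.\<close>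

primrec laguerre :: "nat \<Rightarrow> nat \<Rightarrow> real poly" where
  "laguerre a 0 = 1"
| "laguerre a (Suc N) =
    [:real (Suc N + a), 1:] * laguerre a N + [:0, 1:] * pderiv (laguerre a N)"

lemma has_derivative_laguerre:
  "((\<lambda>x. x ^ (Suc N + a) * exp x * poly (laguerre a N) x) has_real_derivative
    x ^ (N + a) * exp x * poly (laguerre a (Suc N)) x) (at x)"
proof -
  have "((\<lambda>x::real. x ^ (Suc N + a)) has_real_derivative real (Suc N + a) * x ^ (N + a)) (at x)"
    using DERIV_pow[of "Suc N + a" x] by simp
  from DERIV_mult[OF DERIV_mult[OF this DERIV_exp] poly_DERIV] show ?thesis
    by (rule DERIV_cong) (simp add: algebra_simps)
qed

text \<open>The function \<open>g\<close> below vanishes at the \<open>N\<close> old roots, at 0 and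
  in the limit at minus infinity. Each of the \<open>N + 1\<close> gaps contains a zero of its
  derivative, which is a root of the next polynomial.\<close>

lemma laguerre_roots:
  "\<exists>z. strict_mono_on {..<N} z \<and> (\<forall>i<N. z i < 0 \<and> poly (laguerre a N) (z i) = 0)"
proof (induction N)
  case 0
  then show ?case by (auto simp: strict_mono_on_def)
next
  case (Suc N)
  then obtain z where z: "strict_mono_on {..<N} z"
    and neg: "\<And>i. i < N \<Longrightarrow> z i < 0"
    and root: "\<And>i. i < N \<Longrightarrow> poly (laguerre a N) (z i) = 0" by blast
  \<comment> \<open>The extra zero 0 becomes the rightmost one; the exponent
    \<open>Suc N + a\<close> is positive, so \<open>g\<close> vanishes there.\<close>
  define y where "y = z(N := 0)"
  define g where "g = (\<lambda>x. x ^ (Suc N + a) * exp x * poly (laguerre a N) x)"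
  define g' where "g' = (\<lambda>x. x ^ (N + a) * exp x * poly (laguerre a (Suc N)) x)"
  have der: "(g has_real_derivative g' x) (at x)" for x
    unfolding g_def g'_def by (rule has_derivative_laguerre)
  have cont: "continuous_on S g" for S
    using der by (meson DERIV_isCont continuous_at_imp_continuous_on)
  have g0: "g (y i) = 0" if "i \<le> N" for i
    using root[of i] that by (cases "i = N") (auto simp: y_def g_def)
  have ymono: "y i < y j" if "i < j" "j \<le> N" for i j
    using z neg[of i] that by (auto simp: y_def strict_mono_on_def)
  have y0: "y i \<le> 0" if "i \<le> N" for i
    using neg[of i] that by (cases "i = N") (auto simp: y_def)
  \<comment> \<open>Bounding \<open>w\<close> below by all \<open>y j\<close> with
    \<open>j < i\<close> covers the unbounded gap \<open>i = 0\<close> too, where this condition is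
    empty.\<close>
  have "\<exists>w. w < y i \<and> (\<forall>j<i. y j < w) \<and> g' w = 0" if i: "i < Suc N" for i
  proof (cases i)
    case 0
    have "(g \<longlongrightarrow> 0) at_bot"
      using tendsto_poly_times_exp_at_bot[of "monom 1 (Suc N + a) * laguerre a N"]
      by (simp add: g_def poly_monom mult_ac)
    then show ?thesis using Rolle_at_bot[OF der, of "y 0"] g0[of 0] 0 by auto
  next
    case (Suc k)
    have "\<exists>w. y k < w \<and> w < y i \<and> (g has_real_derivative 0) (at w)"
      using Suc i der g0[of k] g0[of i] ymono[of k i]
      by (intro Rolle cont) (auto simp: real_differentiable_def)
    then obtain w where w: "y k < w" "w < y i" "g' w = 0" using DERIV_unique[OF der] by blast
    have "y j < w" if "j < i" for j
      using ymono[of j k] w that Suc i by (cases "j = k") auto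
    then show ?thesis using w by blast
  qed
  then obtain w where w: "\<And>i. i < Suc N \<Longrightarrow> w i < y i"
      "\<And>i j. i < Suc N \<Longrightarrow> j < i \<Longrightarrow> y j < w i" "\<And>i. i < Suc N \<Longrightarrow> g' (w i) = 0"
    by metis
  \<comment> \<open>Interlacing: \<open>w i < y i < w j\<close> for \<open>i < j\<close>.\<close>
  have "strict_mono_on {..<Suc N} w"
    by (rule strict_mono_onI) (meson less_trans lessThan_iff w(1,2))
  moreover have "w i < 0" if "i < Suc N" for i
    using w(1)[OF that] y0[of i] that by simp
  \<comment> \<open>Since \<open>w i\<close> is nonzero, the factor
    \<open>x ^ (N + a) * exp x\<close> of \<open>g'\<close> does not vanish there.\<close>
  moreover from this have "poly (laguerre a (Suc N)) (w i) = 0" if "i < Suc N" for i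
    using w(3)[OF that] that unfolding g'_def by (metis exp_not_eq_zero less_irrefl mult_eq_0_iff power_not_zero)
  ultimately show ?case by blast
qed

section \<open>Coefficients and factorization of the Laguerre polynomials\<close>

lemma coeff_laguerre:
  "coeff (laguerre a N) m = fact N / fact m * real ((N + a) choose (m + a))"
proof (induction N arbitrary: m)
  case 0
  then show ?case by (auto simp: coeff_1)
next
  case (Suc N)
  show ?case
  proof (cases m)
    case 0
    have "real (Suc N) * real ((Suc N + a) choose a) = real (Suc N + a) * real ((N + a) choose a)"
      using binomial_absorb_comp[of "Suc N + a" a] unfolding of_nat_mult[symmetric] by simp
    moreover have "coeff (laguerre a (Suc N)) 0 = fact N * (real (Suc N + a) * real ((N + a) choose a))"
      by (simp add: Suc.IH)
    ultimately show ?thesis using 0 by simp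
  next
    case (Suc l)
    have "Suc (l + a) * ((N + a) choose Suc (l + a)) = (N - l) * ((N + a) choose (l + a))"
      using binomial_absorption[of "l + a" "N + a"] binomial_absorb_comp[of "N + a" "l + a"] by simp
    then have "real (Suc (l + a)) * real ((N + a) choose Suc (l + a)) =
        real (N - l) * real ((N + a) choose (l + a))"
      by (simp only: flip: of_nat_mult)
    \<comment> \<open>For \<open>l > N\<close> the truncated difference is 0, and the binomial
      coefficient vanishes as well.\<close>
    also have "\<dots> = (real N - real l) * real ((N + a) choose (l + a))"
      by (cases "l \<le> N") (auto simp: of_nat_diff not_le)
    finally have absorb: "real (Suc l + a) * real ((N + a) choose (Suc l + a)) =
        (real N - real l) * real ((N + a) choose (l + a))" by simp
    have "coeff (laguerre a (Suc N)) (Suc l) =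
      (real (Suc N + a) + real (Suc l)) * coeff (laguerre a N) (Suc l) + coeff (laguerre a N) l"
      by (simp add: coeff_pCons coeff_pderiv algebra_simps)
    also have "\<dots> = fact N / fact (Suc l) * ((real (Suc N + a) + real (Suc l)) * real ((N + a) choose (Suc l + a))
       + real (Suc l) * real ((N + a) choose (l + a)))"
    proof -
      have "fact N / fact l = fact N / fact (Suc l) * real (Suc l)" by simp
      then show ?thesis by (simp only: Suc.IH) (simp only: distrib_left mult_ac)
    qed
    \<comment> \<open>Split the first factor as \<open>(N + 1) + (l + 1 + a)\<close>;
      \<open>absorb\<close> turns the second part into \<open>N - l\<close> copies of the other
      binomial, and Pascal's rule finishes.\<close>
    also have "\<dots> = fact N / fact (Suc l) * (real (Suc N) * real ((Suc N + a) choose (Suc l + a)))"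
      using absorb by (intro arg_cong2[of _ _ _ _ "(*)"]) (auto simp: algebra_simps)
    finally show ?thesis using Suc by simp
  qed
qed

text \<open>Both sides are monic of degree \<open>N\<close> and agree at \<open>N\<close> distinct
  points.\<close>

lemma laguerre_eq_prod:
  assumes "strict_mono_on {..<N} z" "\<forall>i<N. poly (laguerre a N) (z i) = 0"
  shows "laguerre a N = (\<Prod>i<N. [:- z i, 1:])"
proof (rule poly_eqI_degree_lead_coeff[where n = N and A = "z ` {..<N}"])
  have deg: "degree (\<Prod>i<N. [:- z i, 1:]) = N" by (simp add: degree_prod_eq_sum_degree)
  have "lead_coeff (\<Prod>i<N. [:- z i, 1:]) = 1" by (simp add: lead_coeff_prod)
  then show "coeff (laguerre a N) N = coeff (\<Prod>i<N. [:- z i, 1:]) N"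
    by (simp add: deg coeff_laguerre)
  show "N \<le> card (z ` {..<N})"
    using assms(1) by (simp add: card_image strict_mono_on_imp_inj_on)
  show "degree (laguerre a N) \<le> N" by (rule degree_le) (simp add: coeff_laguerre)
  show "degree (\<Prod>i<N. [:- z i, 1:]) \<le> N" by (simp add: deg)
qed (use assms(2) in \<open>auto simp: poly_prod\<close>)

lemma totally_positive_toeplitz_laguerre: "totally_positive (toeplitz (coeff (laguerre a N)))"
proof -
  obtain z where z: "strict_mono_on {..<N} z" "\<forall>i<N. z i < 0 \<and> poly (laguerre a N) (z i) = 0"
    using laguerre_roots by blast
  then have "laguerre a N = (\<Prod>i<N. [:- z i, 1:])" by (intro laguerre_eq_prod) auto
  then show ?thesis
    using totally_positive_toeplitz_linear_factors[of N z] z(2) by (simp add: less_imp_le)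
qed

section \<open>Passage to the limit\<close>

lemma binomial_div_power_LIMSEQ:
  "(\<lambda>N. real ((N + a) choose k) / real N ^ k) \<longlonglongrightarrow> 1 / fact k"
proof -
  have "(\<lambda>N. (\<Prod>i = 0..<k. (real a - real i) / real N + 1) / fact k)
      \<longlonglongrightarrow> (\<Prod>i = 0..<k. 0 + 1) / fact k"
    by (intro tendsto_intros lim_const_over_n) auto
  moreover have "\<forall>\<^sub>F N in sequentially. (\<Prod>i = 0..<k. (real a - real i) / real N + 1) / fact k =
      real ((N + a) choose k) / real N ^ k"
    using eventually_gt_at_top[of 0]
  proof eventually_elim
    case (elim N)
    have "(\<Prod>i = 0..<k. (real a - real i) / real N + 1) =
        (\<Prod>i = 0..<k. (real (N + a) - real i) / real N)"
      using elim by (intro prod.cong) (auto simp: field_simps)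
    then show ?case
      by (simp add: binomial_gbinomial gbinomial_prod_rev prod_dividef)
  qed
  ultimately show ?thesis by (auto elim: Lim_transform_eventually)
qed

lemma totally_positive_toeplitz_inverse_facts:
  "totally_positive (toeplitz (\<lambda>m. 1 / (fact m * fact (m + a))))"
proof (rule totally_positive_LIMSEQ)
  \<comment> \<open>The \<open>m\<close>-th coefficient must be divided by
    \<open>N! N^(m + a)\<close>. With \<open>m = n - k\<close> this power splits into a row factor
    and a column factor, so the rescaling is diagonal.\<close>
  let ?M = "\<lambda>N n k. (1 / (fact N * real N ^ (n + a))) * real N ^ k * toeplitz (coeff (laguerre a N)) n k"
  show "totally_positive (?M N)" for N
    by (intro totally_positive_diagonal_scale totally_positive_toeplitz_laguerre) auto
  fix n k
  show "(\<lambda>N. ?M N n k) \<longlonglongrightarrow> toeplitz (\<lambda>m. 1 / (fact m * fact (m + a))) n k"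
  proof (cases "k \<le> n")
    case True
    then obtain m where n: "n = m + k" by (metis add.commute le_Suc_ex)
    have "(\<lambda>N. 1 / fact m * (real ((N + a) choose (m + a)) / real N ^ (m + a)))
        \<longlonglongrightarrow> 1 / fact m * (1 / fact (m + a))"
      by (intro tendsto_intros binomial_div_power_LIMSEQ)
    moreover have "\<forall>\<^sub>F N in sequentially.
        1 / fact m * (real ((N + a) choose (m + a)) / real N ^ (m + a)) = ?M N n k"
      using eventually_gt_at_top[of 0]
      by eventually_elim (simp add: n toeplitz_def coeff_laguerre power_add field_simps)
    ultimately show ?thesis
      by (auto simp: n toeplitz_def elim: Lim_transform_eventually)
  qed (simp add: toeplitz_def)
qed

section \<open>The Narayana triangles as scaled Toeplitz matrices\<close>

text \<open>The prefactor \<open>1 / (k + 1)\<close> turns one \<open>k!\<close> into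
  \<open>(k + 1)!\<close>; the remaining factorials depend on \<open>n\<close> alone or on
  \<open>n - k\<close> alone.\<close>

lemma narayana_A_eq:
  "narayana_A = (\<lambda>n k. fact n * fact (n + 1) * (1 / (fact k * fact (k + 1))) *
    toeplitz (\<lambda>m. 1 / (fact m * fact (m + 1))) n k)"
proof (intro ext)
  fix n k
  show "narayana_A n k = fact n * fact (n + 1) * (1 / (fact k * fact (k + 1))) *
    toeplitz (\<lambda>m. 1 / (fact m * fact (m + 1))) n k"
  proof (cases "k \<le> n")
    case True
    then obtain m where n: "n = m + k" by (metis add.commute le_Suc_ex)
    have "real ((n + 1) choose k) = fact (n + 1) / (fact k * fact (m + 1))"
      "real (n choose k) = fact n / (fact k * fact m)"
      by (simp_all add: n binomial_fact del: fact_Suc)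
    moreover have "fact (k + 1) = (real k + 1) * fact k" by simp
    ultimately show ?thesis
      by (simp add: n narayana_A_def toeplitz_def mult_ac del: fact_Suc)
  qed (simp add: narayana_A_def toeplitz_def)
qed

text \<open>The form \<open>m + 0\<close> makes the Toeplitz factor the instance
  \<open>a = 0\<close> of the limit sequence.\<close>

lemma narayana_B_eq:
  "narayana_B = (\<lambda>n k. fact n * fact n * (1 / (fact k * fact k)) *
    toeplitz (\<lambda>m. 1 / (fact m * fact (m + 0))) n k)"
  by (intro ext) (simp add: narayana_B_def toeplitz_def binomial_fact power2_eq_square)

theorem theorem2p2:
  shows "totally_positive narayana_A \<and> totally_positive narayana_B"
  unfolding narayana_A_eq narayana_B_eq
  by (intro conjI totally_positive_diagonal_scale totally_positive_toeplitz_inverse_facts) simp_all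

end
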